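(* For any $\alpha\in(1.26,1.71)$, if $\gamma_4\in(a_3,a_4)$, then the third-order Crank--Nicolson scheme $$\left(I-\frac{\tau}{2h^\alpha}(c_lB_\lambda+c_rB_\lambda^T)\right)U^{j+1}=\left(I+\frac{\tau}{2h^\alpha}(c_lB_\lambda+c_rB_\lambda^T)\right)U^{j}+\tau\hat F^{\,j+\frac12}$$ is unconditionally stable.
   Context: The scheme discretizes the tempered fractional diffusion equation $\partial_t u=c_l\,{}_a\mathfrak{D}_x^{\alpha,\lambda}u+c_r\,{}_x\mathfrak{D}_b^{\alpha,\lambda}u+f(x,t)$ on $(a,b)\times(0,T)$, with $\lambda\ge0$ and prescribed values $u(a,t)=\Phi_l(t)$, $u(b,t)=\Phi_r(t)$. Here $c_l,c_r$ are constants with $c_l+c_r\neq0$; if $c_l\ne0$ then $\Phi_l\equiv0$, and if $c_r\neq0$ then $\Phi_r\equiv0$. The operators are ${}_a\mathfrak{D}_x^{\alpha,\lambda}u=e^{-\lambda x}{}_aD_x^\alpha(e^{\lambda x}u)-\lambda^\alpha u$ and ${}_x\mathfrak{D}_b^{\alpha,\lambda}u=e^{\lambda x}{}_xD_b^\alpha(e^{-\lambda x}u)-\lambda^\alpha u$, with ${}_aD_x^\alpha$, ${}_xD_b^\alpha$ the left and right Riemann--Liouville derivatives of order $\alpha$. The grid is $x_i=a+ih$, $0\le i\le M$, $h=(b-a)/M$, and $t_j=j\tau$, $0\le j\le N$, $\tau=T/N$. The vector $U^j=(U_1^j,\dots,U_{M-1}^j)^T$ is the numerical solution at time $t_j$,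 and $\hat F^{\,j+\frac12}$ collects source and boundary data. "Unconditionally stable" is used in the usual sense for time-stepping schemes; no formal definition is given. The numbers $a_3,a_4$ (depending on $\alpha$) are $$a_3=\max\left\{\frac{\frac{\alpha^5}{8}+\frac{7}{12}\alpha^4-\frac{5}{8}\alpha^3-\frac{49}{12}\alpha^2+3\alpha}{\alpha^3+6\alpha^2+11\alpha+6},\ \frac{\frac{\alpha^5}{8}+\frac{\alpha^4}{3}-\frac{67}{24}\alpha^3-\frac{23}{6}\alpha^2+\frac{175}{6}\alpha-30}{\alpha^3+6\alpha^2+11\alpha+6}\right\},$$ $$a_4=\min\left\{\frac{\frac{1}{8}\alpha^4+\frac{7}{12}\alpha^3+\frac{1}{8}\alpha^2-\frac{13}{6}\alpha}{\alpha^2+5\alpha+8},\ \frac{\frac{\alpha^5}{8}+\frac{11}{24}\alpha^4-\frac{41}{24}\alpha^3-\frac{107}{24}\alpha^2+\frac{163}{12}\alpha-8}{\alpha^3+6\alpha^2+11\alpha+6}\right\}.$$ Let $\omega_k^{(\alpha)}=(-1)^k\binom{\alpha}{k}$, $k\ge0$. Given $\gamma_4$, set $$\gamma_1=\tfrac{\alpha^2}{8}+\tfrac{5}{24}\alpha-\gamma_4,\quad \gamma_2=-\tfrac{\alpha^2}{4}+\tfrac{1}{12}\alpha+1+3\gamma_4,\quad \gamma_3=\tfrac{\alpha^2}{8}-\tfrac{7}{24}\alpha-3\gamma_4 .$$ The third-order weights are $$g_{0,\lambda}=\gamma_1\omega_0^{(\alpha)}e^{h\lambda},\quad g_{1,\lambda}=\gamma_1\omega_1^{(\alpha)}+\gamma_2\omega_0^{(\alpha)},\quad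 g_{2,\lambda}=\left(\gamma_1\omega_2^{(\alpha)}+\gamma_2\omega_1^{(\alpha)}+\gamma_3\omega_0^{(\alpha)}\right)e^{-h\lambda},$$ $$g_{k,\lambda}=\left(\gamma_1\omega_k^{(\alpha)}+\gamma_2\omega_{k-1}^{(\alpha)}+\gamma_3\omega_{k-2}^{(\alpha)}+\gamma_4\omega_{k-3}^{(\alpha)}\right)e^{-(k-1)h\lambda}\quad(k\ge3),$$ and $\phi(\lambda)=\left(\gamma_1e^{h\lambda}+\gamma_2+\gamma_3e^{-h\lambda}+\gamma_4e^{-2h\lambda}\right)(1-e^{-h\lambda})^\alpha$. $B_\lambda$ is the $(M-1)\times(M-1)$ Toeplitz matrix with $(B_\lambda)_{ii}=g_{1,\lambda}-\phi(\lambda)$, $(B_\lambda)_{i,i+1}=g_{0,\lambda}$, $(B_\lambda)_{i,l}=g_{i-l+1,\lambda}$ for $l<i$, and $(B_\lambda)_{i,l}=0$ for $l>i+1$.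
   Formalization: The formal statement assumes c_l + c_r > 0 instead of c_l + c_r ≠ 0; for c_l + c_r < 0 the equation is backward diffusion and the scheme's amplification is unbounded as the grid is refined, so the claim fails there. *)

theory Defs
  imports Complex_Main "Jordan_Normal_Form.Matrix"
begin

definition a3 :: "real \<Rightarrow> real" where
  "a3 \<alpha> = max
     ((\<alpha>^5 / 8 + 7 / 12 * \<alpha>^4 - 5 / 8 * \<alpha>^3 - 49 / 12 * \<alpha>^2 + 3 * \<alpha>)
        / (\<alpha>^3 + 6 * \<alpha>^2 + 11 * \<alpha> + 6))
     ((\<alpha>^5 / 8 + \<alpha>^4 / 3 - 67 / 24 * \<alpha>^3 - 23 / 6 * \<alpha>^2 + 175 / 6 * \<alpha> - 30)
        / (\<alpha>^3 + 6 * \<alpha>^2 + 11 * \<alpha> + 6))"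

definition a4 :: "real \<Rightarrow> real" where
  "a4 \<alpha> = min
     ((1 / 8 * \<alpha>^4 + 7 / 12 * \<alpha>^3 + 1 / 8 * \<alpha>^2 - 13 / 6 * \<alpha>)
        / (\<alpha>^2 + 5 * \<alpha> + 8))
     ((\<alpha>^5 / 8 + 11 / 24 * \<alpha>^4 - 41 / 24 * \<alpha>^3 - 107 / 24 * \<alpha>^2 + 163 / 12 * \<alpha> - 8)
        / (\<alpha>^3 + 6 * \<alpha>^2 + 11 * \<alpha> + 6))"

definition \<omega> :: "real \<Rightarrow> nat \<Rightarrow> real" where
  "\<omega> \<alpha> k = (-1)^k * (\<alpha> gchoose k)"

definition \<gamma>1 :: "real \<Rightarrow> real \<Rightarrow> real" where
  "\<gamma>1 \<alpha> \<gamma>4 = \<alpha>^2 / 8 + 5 / 24 * \<alpha> - \<gamma>4"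

definition \<gamma>2 :: "real \<Rightarrow> real \<Rightarrow> real" where
  "\<gamma>2 \<alpha> \<gamma>4 = - (\<alpha>^2 / 4) + 1 / 12 * \<alpha> + 1 + 3 * \<gamma>4"

definition \<gamma>3 :: "real \<Rightarrow> real \<Rightarrow> real" where
  "\<gamma>3 \<alpha> \<gamma>4 = \<alpha>^2 / 8 - 7 / 24 * \<alpha> - 3 * \<gamma>4"

definition g :: "real \<Rightarrow> real \<Rightarrow> real \<Rightarrow> real \<Rightarrow> nat \<Rightarrow> real" where
  "g \<alpha> \<gamma>4 lam h k =
     (if k = 0 then \<gamma>1 \<alpha> \<gamma>4 * \<omega> \<alpha> 0 * exp (h * lam)
      else if k = 1 then \<gamma>1 \<alpha> \<gamma>4 * \<omega> \<alpha> 1 + \<gamma>2 \<alpha> \<gamma>4 * \<omega> \<alpha> 0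
      else if k = 2 then
        (\<gamma>1 \<alpha> \<gamma>4 * \<omega> \<alpha> 2 + \<gamma>2 \<alpha> \<gamma>4 * \<omega> \<alpha> 1 + \<gamma>3 \<alpha> \<gamma>4 * \<omega> \<alpha> 0) * exp (- (h * lam))
      else
        (\<gamma>1 \<alpha> \<gamma>4 * \<omega> \<alpha> k + \<gamma>2 \<alpha> \<gamma>4 * \<omega> \<alpha> (k - 1) + \<gamma>3 \<alpha> \<gamma>4 * \<omega> \<alpha> (k - 2)
          + \<gamma>4 * \<omega> \<alpha> (k - 3)) * exp (- ((real k - 1) * h * lam)))"

definition \<phi> :: "real \<Rightarrow> real \<Rightarrow> real \<Rightarrow> real \<Rightarrow> real" where
  "\<phi> \<alpha> \<gamma>4 lam h =
     (\<gamma>1 \<alpha> \<gamma>4 * exp (h * lam) + \<gamma>2 \<alpha> \<gamma>4 + \<gamma>3 \<alpha> \<gamma>4 * exp (- (h * lam))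
       + \<gamma>4 * exp (- (2 * h * lam))) * (1 - exp (- (h * lam))) powr \<alpha>"

(* Rows and columns are numbered from 0, so index i stands for the grid point a + (i + 1) h;
   the entries depend only on the difference of the two indices. *)
definition B :: "real \<Rightarrow> real \<Rightarrow> real \<Rightarrow> real \<Rightarrow> nat \<Rightarrow> real mat" where
  "B \<alpha> \<gamma>4 lam h n = mat n n (\<lambda>(i, l).
     if l = i then g \<alpha> \<gamma>4 lam h 1 - \<phi> \<alpha> \<gamma>4 lam h
     else if l = i + 1 then g \<alpha> \<gamma>4 lam h 0
     else if l < i then g \<alpha> \<gamma>4 lam h (i - l + 1)
     else 0)"

definition cn_mat :: "real \<Rightarrow> real \<Rightarrow> real \<Rightarrow> real \<Rightarrow> real \<Rightarrow> real \<Rightarrow> real \<Rightarrow> nat \<Rightarrow> real mat" where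
  "cn_mat \<alpha> \<gamma>4 lam cl cr h \<tau> n =
     (\<tau> / (2 * h powr \<alpha>)) \<cdot>\<^sub>m
       (cl \<cdot>\<^sub>m B \<alpha> \<gamma>4 lam h n + cr \<cdot>\<^sub>m transpose_mat (B \<alpha> \<gamma>4 lam h n))"

(* F j is the source and boundary vector at time level j + 1/2. It is left arbitrary, so every
   choice of source term and admissible boundary values is covered. *)
definition cn_solution ::
    "real \<Rightarrow> real \<Rightarrow> real \<Rightarrow> real \<Rightarrow> real \<Rightarrow>
     real \<Rightarrow> real \<Rightarrow> nat \<Rightarrow> nat \<Rightarrow> (nat \<Rightarrow> real vec) \<Rightarrow> (nat \<Rightarrow> real vec) \<Rightarrow> bool" where
  "cn_solution \<alpha> \<gamma>4 lam cl cr h \<tau> n N F U \<longleftrightarrow>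
     (\<forall>j\<le>N. U j \<in> carrier_vec n) \<and>
     (\<forall>j<N. (1\<^sub>m n - cn_mat \<alpha> \<gamma>4 lam cl cr h \<tau> n) *\<^sub>v U (j + 1)
           = (1\<^sub>m n + cn_mat \<alpha> \<gamma>4 lam cl cr h \<tau> n) *\<^sub>v U j + \<tau> \<cdot>\<^sub>v F j)"

definition discrete_L2_norm :: "real \<Rightarrow> real vec \<Rightarrow> real" where
  "discrete_L2_norm h v = sqrt (h * (\<Sum>i<dim_vec v. (v $ i)\<^sup>2))"

(* Lax-Richtmyer stability in the discrete L2 norm, with no relation imposed between the time
   step and the mesh width: the constant K is the same for all M, N, time levels and data.
   sol h \<tau> n N F U says that U 0, ..., U N solves the scheme with data F. For equal initial
   vectors the bound gives uniqueness, so each scheme is also required to be uniquely solvable. *)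
definition unconditionally_stable ::
    "real \<Rightarrow> real \<Rightarrow> real \<Rightarrow>
     (real \<Rightarrow> real \<Rightarrow> nat \<Rightarrow> nat \<Rightarrow> (nat \<Rightarrow> real vec) \<Rightarrow> (nat \<Rightarrow> real vec) \<Rightarrow> bool) \<Rightarrow> bool" where
  "unconditionally_stable a b T sol \<longleftrightarrow>
     (\<exists>K. \<forall>M\<ge>1. \<forall>N\<ge>1. \<forall>h \<tau> n. h = (b - a) / real M \<longrightarrow> \<tau> = T / real N \<longrightarrow> n = M - 1 \<longrightarrow>
        (\<forall>F. (\<forall>j<N. F j \<in> carrier_vec n) \<longrightarrow>
           (\<forall>u0 \<in> carrier_vec n. \<exists>U. U 0 = u0 \<and> sol h \<tau> n N F U) \<and>
           (\<forall>U V. sol h \<tau> n N F U \<longrightarrow> sol h \<tau> n N F V \<longrightarrow>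
              (\<forall>j\<le>N. discrete_L2_norm h (U j - V j) \<le> K * discrete_L2_norm h (U 0 - V 0)))))"

end

(* The symmetric part of B is diagonally dominant with nonpositive diagonal. Its off-diagonal entries
   are nonnegative: for k >= 3 the sign of g_k is that of omega_{k-3} P(k), where P is a cubic, and
   the bounds a3 < gamma4 < a4 say exactly that P(3) > 0, P(4) < 0, P(5) > 0 and g_0 + g_2 > 0 (for
   lambda = 0); P increases from 5 on. By the binomial series phi is the sum of all g_k, so that
   every row sum is nonpositive. Since (c_l + c_r) x^T B x = x^T (c_l B + c_r B^T) x, the
   Crank-Nicolson matrix A satisfies x^T A x <= 0. If (I - A) u = (I + A) v, then
   u - v = A (u + v), and pairing with u + v gives |u| <= |v|. *)
theory Submission
  imports "HOL-Analysis.Generalised_Binomial_Theorem" Defs "Jordan_Normal_Form.Determinant"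
begin

unbundle no inner_syntax and no vec_syntax
hide_type (open) Finite_Cartesian_Product.vec

section \<open>The third-order weights\<close>

lemma omega_0 [simp]: "\<omega> \<alpha> 0 = 1"
  by (simp add: \<omega>_def)

lemma omega_Suc: "(real k + 1) * \<omega> \<alpha> (Suc k) = (real k - \<alpha>) * \<omega> \<alpha> k"
proof -
  have "\<alpha> * (\<alpha> gchoose k) = real k * (\<alpha> gchoose k) + real (Suc k) * (\<alpha> gchoose Suc k)"
    by (rule gbinomial_mult_1)
  then have step: "(real k + 1) * (\<alpha> gchoose Suc k) = - ((real k - \<alpha>) * (\<alpha> gchoose k))"
    by (simp add: algebra_simps)
  have "(real k + 1) * \<omega> \<alpha> (Suc k) = - ((- 1) ^ k * ((real k + 1) * (\<alpha> gchoose Suc k)))"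
    by (simp add: \<omega>_def)
  also have "\<dots> = (real k - \<alpha>) * \<omega> \<alpha> k"
    unfolding step by (simp add: \<omega>_def)
  finally show ?thesis .
qed

lemma omega_1 [simp]: "\<omega> \<alpha> (Suc 0) = - \<alpha>"
  using omega_Suc[of 0 \<alpha>] by simp

text \<open>The value at 2 is \<alpha>(\<alpha> - 1)/2, and from there on every ratio (k -
  \<alpha>)/(k + 1) is positive because \<alpha> < 2 \<le> k.\<close>

lemma omega_pos:
  assumes "1 < \<alpha>" "\<alpha> < 2" "2 \<le> k"
  shows "0 < \<omega> \<alpha> k"
  using assms(3)
proof (induction k rule: dec_induct)
  case base
  have "2 * \<omega> \<alpha> 2 = (\<alpha> - 1) * \<alpha>"
    using omega_Suc[of 1 \<alpha>] by (simp add: numeral_2_eq_2 algebra_simps)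
  moreover have "0 < (\<alpha> - 1) * \<alpha>"
    using assms(1) by simp
  ultimately show ?case
    by linarith
next
  case (step k)
  then have "0 < (real k - \<alpha>) * \<omega> \<alpha> k"
    using assms(1,2) by simp
  then have "0 < (real k + 1) * \<omega> \<alpha> (Suc k)"
    by (simp only: omega_Suc)
  then show ?case
    by (rule zero_less_mult_pos) simp
qed

section \<open>Untempered weights as binomial coefficients times a cubic\<close>

definition weight_cubic :: "real \<Rightarrow> real \<Rightarrow> real \<Rightarrow> real" where
  "weight_cubic \<alpha> \<gamma>4 x =
     \<gamma>1 \<alpha> \<gamma>4 * (x - 1 - \<alpha>) * (x - 2 - \<alpha>) * (x - 3 - \<alpha>)
     + \<gamma>2 \<alpha> \<gamma>4 * x * (x - 2 - \<alpha>) * (x - 3 - \<alpha>)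
     + \<gamma>3 \<alpha> \<gamma>4 * x * (x - 1) * (x - 3 - \<alpha>)
     + \<gamma>4 * x * (x - 1) * (x - 2)"

text \<open>Setting \<open>lam\<close> and \<open>h\<close> to 0 turns all exponentials into 1 and
  leaves the untempered weight. Signs then reduce to the case \<lambda> = 0, and sums of weights
  become a power series in exp(-h\<lambda>).\<close>

lemma g_temper: "g \<alpha> \<gamma>4 lam h k = g \<alpha> \<gamma>4 0 0 k * exp (- (h * lam)) ^ k * exp (h * lam)"
proof -
  have "exp (- (h * lam)) ^ k * exp (h * lam) = exp (- ((real k - 1) * h * lam))"
    by (simp add: exp_of_nat_mult[symmetric] exp_add[symmetric] algebra_simps)
  then show ?thesis
    by (auto simp: g_def mult.assoc)
qed

text \<open>By \<open>omega_Suc\<close> the three later coefficients are multiples of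
  \<open>\<omega> \<alpha> k\<close> by products of ratios (r - \<alpha>)/(r + 1). Clearing the
  denominators leaves \<open>weight_cubic\<close> at the index k + 3 of the weight.\<close>

lemma g_eq_weight_cubic:
  "g \<alpha> \<gamma>4 0 0 (k + 3) * (real (k + 1) * real (k + 2) * real (k + 3))
     = \<omega> \<alpha> k * weight_cubic \<alpha> \<gamma>4 (real (k + 3))"
proof -
  define r w where "r = real k" and "w = \<omega> \<alpha> k"
  have 1: "(r + 1) * \<omega> \<alpha> (k + 1) = w * (r - \<alpha>)"
    using omega_Suc[of k \<alpha>] by (simp add: r_def w_def mult.commute)
  have "(r + 2) * \<omega> \<alpha> (k + 2) = \<omega> \<alpha> (k + 1) * (r + 1 - \<alpha>)"
    using omega_Suc[of "k + 1" \<alpha>] by (simp add: r_def add_ac mult.commute)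
  then have 2: "(r + 1) * (r + 2) * \<omega> \<alpha> (k + 2) = w * (r - \<alpha>) * (r + 1 - \<alpha>)"
    by (metis 1 mult.assoc)
  have "(r + 3) * \<omega> \<alpha> (k + 3) = \<omega> \<alpha> (k + 2) * (r + 2 - \<alpha>)"
    using omega_Suc[of "k + 2" \<alpha>] by (simp add: r_def add_ac mult.commute numeral_3_eq_3)
  then have 3: "(r + 1) * (r + 2) * (r + 3) * \<omega> \<alpha> (k + 3)
      = w * (r - \<alpha>) * (r + 1 - \<alpha>) * (r + 2 - \<alpha>)"
    by (metis 2 mult.assoc)
  have g: "g \<alpha> \<gamma>4 0 0 (k + 3) = \<gamma>1 \<alpha> \<gamma>4 * \<omega> \<alpha> (k + 3) + \<gamma>2 \<alpha> \<gamma>4 * \<omega> \<alpha> (k + 2)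
      + \<gamma>3 \<alpha> \<gamma>4 * \<omega> \<alpha> (k + 1) + \<gamma>4 * w"
    by (simp add: g_def w_def)
  have "g \<alpha> \<gamma>4 0 0 (k + 3) * ((r + 1) * (r + 2) * (r + 3))
      = \<gamma>1 \<alpha> \<gamma>4 * ((r + 1) * (r + 2) * (r + 3) * \<omega> \<alpha> (k + 3))
        + \<gamma>2 \<alpha> \<gamma>4 * (r + 3) * ((r + 1) * (r + 2) * \<omega> \<alpha> (k + 2))
        + \<gamma>3 \<alpha> \<gamma>4 * (r + 3) * (r + 2) * ((r + 1) * \<omega> \<alpha> (k + 1))
        + \<gamma>4 * w * ((r + 1) * (r + 2) * (r + 3))"
    unfolding g by (simp add: algebra_simps)
  also have "\<dots> = w * weight_cubic \<alpha> \<gamma>4 (r + 3)"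
    unfolding 1 2 3 weight_cubic_def by (simp add: algebra_simps)
  finally show ?thesis
    by (simp add: r_def w_def add_ac)
qed

text \<open>As a polynomial in \<open>x\<close>, \<^const>\<open>weight_cubic\<close> is monic and depends on \<open>\<gamma>4\<close> only through its
  constant term.\<close>
lemma weight_cubic_expand:
  "weight_cubic \<alpha> \<gamma>4 x
     = x ^ 3 - (5 + 5 * \<alpha> / 2 + \<alpha>\<^sup>2 / 2) * x\<^sup>2
       + ((\<alpha> + 2) * (\<alpha> + 3) + (\<alpha> + 1) * (\<alpha> ^ 3 / 8 + 23 * \<alpha>\<^sup>2 / 24 + 23 * \<alpha> / 12)) * x
       - (\<alpha>\<^sup>2 / 8 + 5 * \<alpha> / 24 - \<gamma>4) * ((\<alpha> + 1) * (\<alpha> + 2) * (\<alpha> + 3))"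
  unfolding weight_cubic_def \<gamma>1_def \<gamma>2_def \<gamma>3_def
  by (simp add: field_simps power2_eq_square power3_eq_cube)

lemma den_eq: "(\<alpha> + 1) * (\<alpha> + 2) * (\<alpha> + 3) = \<alpha> ^ 3 + 6 * \<alpha>\<^sup>2 + 11 * \<alpha> + (6::real)"
  by (simp add: field_simps power2_eq_square power3_eq_cube)

section \<open>Signs of the weights for \<gamma>4 between \<open>a3\<close> and \<open>a4\<close>,
  and their sums\<close>

context
  fixes \<alpha> \<gamma>4 :: real
  assumes \<alpha>: "1.26 < \<alpha>" "\<alpha> < 1.71"
    and \<gamma>4: "a3 \<alpha> < \<gamma>4" "\<gamma>4 < a4 \<alpha>"
begin

lemma den_pos: "0 < \<alpha> ^ 3 + 6 * \<alpha>\<^sup>2 + 11 * \<alpha> + 6"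
  using \<alpha> by (intro add_pos_pos) auto

text \<open>At a fixed point the cubic is affine in \<gamma>4, with the positive slope (\<alpha> +
  1)(\<alpha> + 2)(\<alpha> + 3), the denominator in \<open>a3\<close>. At the point 3 its zero in
  \<gamma>4 is the first entry of \<open>a3\<close>; at 4 and 5 the zeros are the second entries of
  \<open>a4\<close> and \<open>a3\<close>.\<close>

lemma weight_cubic_3_pos: "0 < weight_cubic \<alpha> \<gamma>4 3"
proof -
  have "(\<alpha>^5 / 8 + 7 / 12 * \<alpha>^4 - 5 / 8 * \<alpha>^3 - 49 / 12 * \<alpha>^2 + 3 * \<alpha>)
      < \<gamma>4 * (\<alpha> ^ 3 + 6 * \<alpha>\<^sup>2 + 11 * \<alpha> + 6)"
    using \<gamma>4(1) den_pos unfolding a3_def by (simp add: pos_divide_less_eq)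
  then show ?thesis
    unfolding weight_cubic_expand by (simp add: field_simps eval_nat_numeral)
qed

lemma weight_cubic_4_neg: "weight_cubic \<alpha> \<gamma>4 4 < 0"
proof -
  have "\<gamma>4 * (\<alpha> ^ 3 + 6 * \<alpha>\<^sup>2 + 11 * \<alpha> + 6)
     < \<alpha>^5 / 8 + 11 / 24 * \<alpha>^4 - 41 / 24 * \<alpha>^3 - 107 / 24 * \<alpha>^2 + 163 / 12 * \<alpha> - 8"
    using \<gamma>4(2) den_pos unfolding a4_def by (simp add: pos_less_divide_eq)
  then show ?thesis
    unfolding weight_cubic_expand by (simp add: field_simps eval_nat_numeral)
qed

lemma weight_cubic_5_pos: "0 < weight_cubic \<alpha> \<gamma>4 5"
proof -
  have "\<alpha>^5 / 8 + \<alpha>^4 / 3 - 67 / 24 * \<alpha>^3 - 23 / 6 * \<alpha>^2 + 175 / 6 * \<alpha> - 30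
      < \<gamma>4 * (\<alpha> ^ 3 + 6 * \<alpha>\<^sup>2 + 11 * \<alpha> + 6)"
    using \<gamma>4(1) den_pos unfolding a3_def by (simp add: pos_divide_less_eq)
  then show ?thesis
    unfolding weight_cubic_expand by (simp add: field_simps eval_nat_numeral)
qed

text \<open>Taylor expansion at 5: the derivative there is \<open>c\<close>, half the second
  derivative is 10 - 5\<alpha>/2 - \<alpha>^2/2, and both are positive on the range of
  \<alpha>.\<close>

lemma weight_cubic_pos:
  assumes "0 \<le> m"
  shows "0 < weight_cubic \<alpha> \<gamma>4 (5 + m)"
proof -
  define c where "c = 31 - 20 * \<alpha> - 4 * \<alpha>\<^sup>2
    + (\<alpha> + 1) * (\<alpha> ^ 3 / 8 + 23 * \<alpha>\<^sup>2 / 24 + 23 * \<alpha> / 12)"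
  have c: "0 < c"
  proof -
    \<comment> \<open>Expanded around the right endpoint 1.71, \<open>c\<close> has a single
      negative coefficient, that of s^3. Since s is below the interval length 0.45, the s^2 term
      absorbs it.\<close>
    define s where "s = 171 / 100 - \<alpha>"
    have s: "0 < s" "s < 45 / 100"
      using \<alpha> by (simp_all add: s_def)
    have "s * s\<^sup>2 \<le> 45 / 100 * s\<^sup>2"
      using s by (intro mult_right_mono) auto
    then have s3: "s ^ 3 \<le> 45 / 100 * s\<^sup>2"
      by (simp add: power2_eq_square power3_eq_cube)
    have a: "\<alpha> = 171 / 100 - s"
      by (simp add: s_def)
    have "c = 2618862281 / 800000000 + 59564417 / 6000000 * s + 265023 / 40000 * s\<^sup>2
        - 1163 / 600 * s ^ 3 + s ^ 4 / 8"
      unfolding c_def a by (simp add: field_simps power2_eq_square power3_eq_cube power4_eq_xxxx)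
    moreover have "0 \<le> s ^ 4" "0 \<le> s\<^sup>2"
      by simp_all
    ultimately show ?thesis
      using s s3 by linarith
  qed
  have "\<alpha>\<^sup>2 < 2\<^sup>2"
    using \<alpha> by (intro power_strict_mono) auto
  then have b: "0 < 10 - 5 * \<alpha> / 2 - \<alpha>\<^sup>2 / 2"
    using \<alpha> by simp
  have "weight_cubic \<alpha> \<gamma>4 (5 + m)
      = weight_cubic \<alpha> \<gamma>4 5 + m * (m\<^sup>2 + (10 - 5 * \<alpha> / 2 - \<alpha>\<^sup>2 / 2) * m + c)"
    unfolding weight_cubic_expand c_def by (simp add: field_simps eval_nat_numeral)
  moreover have "0 \<le> m * (m\<^sup>2 + (10 - 5 * \<alpha> / 2 - \<alpha>\<^sup>2 / 2) * m + c)"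
    using assms b c by (intro mult_nonneg_nonneg add_nonneg_nonneg) auto
  ultimately show ?thesis
    using weight_cubic_5_pos by linarith
qed

text \<open>Both factors in \<open>g_eq_weight_cubic\<close> have the sign pattern +, -, +, +, ... :
  \<open>\<omega> \<alpha> 1\<close> = -\<alpha> is the only negative coefficient, and it meets the
  negative value of the cubic at 4.\<close>

lemma untempered_weight_nonneg:
  assumes "3 \<le> k"
  shows "0 \<le> g \<alpha> \<gamma>4 0 0 k"
proof -
  obtain j where k: "k = j + 3"
    using assms by (metis add.commute le_Suc_ex)
  have "0 \<le> \<omega> \<alpha> j * weight_cubic \<alpha> \<gamma>4 (real (j + 3))"
  proof -
    consider "j = 0" | "j = 1" | i where "j = i + 2"
      by (metis One_nat_def add_2_eq_Suc' not0_implies_Suc)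
    then show ?thesis
    proof cases
      case 1
      then show ?thesis using weight_cubic_3_pos by simp
    next
      case 2
      then show ?thesis
        using weight_cubic_4_neg \<alpha> by (simp add: mult_nonneg_nonpos)
    next
      case 3
      have "0 < \<omega> \<alpha> j" "0 < weight_cubic \<alpha> \<gamma>4 (5 + real i)"
        using \<alpha> 3 by (auto intro: omega_pos weight_cubic_pos)
      then show ?thesis
        using 3 by (simp add: add_ac)
    qed
  qed
  then have "0 \<le> g \<alpha> \<gamma>4 0 0 k * (real (j + 1) * real (j + 2) * real (j + 3))"
    unfolding k g_eq_weight_cubic .
  moreover have "0 < real (j + 1) * real (j + 2) * real (j + 3)"
    by simp
  ultimately show ?thesis
    using zero_le_mult_iff by (metis not_less)
qed

lemma weight_nonneg:
  assumes "3 \<le> k"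
  shows "0 \<le> g \<alpha> \<gamma>4 lam h k"
  unfolding g_temper[of _ _ lam] using untempered_weight_nonneg[OF assms] by simp

text \<open>The right side minus the left side is twice \<open>g\<close> at 0 plus \<open>g\<close>
  at 2 for \<lambda> = 0; the same bound also yields \<open>gamma1_pos\<close>.\<close>

lemma a4_bound: "\<gamma>4 * (\<alpha>\<^sup>2 + 5 * \<alpha> + 8) < 1 / 8 * \<alpha>^4 + 7 / 12 * \<alpha>^3 + 1 / 8 * \<alpha>^2 - 13 / 6 * \<alpha>"
proof -
  have "0 < \<alpha>\<^sup>2 + 5 * \<alpha> + 8"
    using \<alpha> by (intro add_pos_pos) auto
  then show ?thesis
    using \<gamma>4(2) unfolding a4_def by (simp add: pos_less_divide_eq)
qed

text \<open>The claim is \<gamma>4 < \<alpha>^2/8 + 5\<alpha>/24. After multiplication by \<alpha>^2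
  + 5\<alpha> + 8, this bound exceeds the one from \<open>a4_bound\<close> by a polynomial in
  \<alpha> with positive coefficients and no constant term.\<close>

lemma gamma1_pos: "0 < \<gamma>1 \<alpha> \<gamma>4"
proof -
  have d: "0 < \<alpha>\<^sup>2 + 5 * \<alpha> + 8"
    using \<alpha> by (intro add_pos_pos) auto
  have "0 < \<alpha>\<^sup>2" "0 < \<alpha> ^ 3"
    using \<alpha> by auto
  then have "1 / 8 * \<alpha>^4 + 7 / 12 * \<alpha>^3 + 1 / 8 * \<alpha>^2 - 13 / 6 * \<alpha>
      \<le> (\<alpha>\<^sup>2 / 8 + 5 / 24 * \<alpha>) * (\<alpha>\<^sup>2 + 5 * \<alpha> + 8)"
    using \<alpha> by (simp add: field_simps eval_nat_numeral)
  with a4_bound have "\<gamma>4 * (\<alpha>\<^sup>2 + 5 * \<alpha> + 8) < (\<alpha>\<^sup>2 / 8 + 5 / 24 * \<alpha>) * (\<alpha>\<^sup>2 + 5 * \<alpha> + 8)"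
    by linarith
  then show ?thesis
    using d unfolding \<gamma>1_def by (simp add: mult_less_cancel_right_pos)
qed

text \<open>In the symmetric part of \<open>B\<close> these two weights share the entries next to
  the diagonal, so only their sum needs a sign. Tempering enlarges the positive weight at 0 and
  shrinks the one at 2, which keeps the sum nonnegative.\<close>

lemma weight_0_2_nonneg:
  assumes "0 \<le> h * lam"
  shows "0 \<le> g \<alpha> \<gamma>4 lam h 0 + g \<alpha> \<gamma>4 lam h 2"
proof -
  have w2: "\<omega> \<alpha> 2 = \<alpha> * (\<alpha> - 1) / 2"
    using omega_Suc[of 1 \<alpha>] by (simp add: numeral_2_eq_2 field_simps)
  have "0 < g \<alpha> \<gamma>4 0 0 0 + g \<alpha> \<gamma>4 0 0 2"
    using a4_bound unfolding g_def w2 \<gamma>1_def \<gamma>2_def \<gamma>3_def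
    by (simp add: field_simps eval_nat_numeral)
  moreover have "0 < g \<alpha> \<gamma>4 0 0 0"
    using gamma1_pos by (simp add: g_def)
  moreover have "exp (- (h * lam)) \<le> exp (h * lam)"
    using assms by simp
  ultimately have "0 \<le> g \<alpha> \<gamma>4 0 0 0 * (exp (h * lam) - exp (- (h * lam)))"
      "0 \<le> (g \<alpha> \<gamma>4 0 0 0 + g \<alpha> \<gamma>4 0 0 2) * exp (- (h * lam))"
    by (simp_all del: exp_le_cancel_iff)
  then have "0 \<le> g \<alpha> \<gamma>4 0 0 0 * (exp (h * lam) - exp (- (h * lam)))
      + (g \<alpha> \<gamma>4 0 0 0 + g \<alpha> \<gamma>4 0 0 2) * exp (- (h * lam))"
    by (rule add_nonneg_nonneg)
  also have "\<dots> = g \<alpha> \<gamma>4 lam h 0 + g \<alpha> \<gamma>4 lam h 2"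
    unfolding g_temper[of _ _ lam]
    by (simp add: algebra_simps power2_eq_square exp_minus)
  finally show ?thesis .
qed

lemma untempered_weight_sums:
  fixes z :: real
  assumes "\<bar>z\<bar> < 1"
  shows "(\<lambda>k. g \<alpha> \<gamma>4 0 0 k * z ^ k) sums
    ((\<gamma>1 \<alpha> \<gamma>4 + \<gamma>2 \<alpha> \<gamma>4 * z + \<gamma>3 \<alpha> \<gamma>4 * z\<^sup>2 + \<gamma>4 * z ^ 3) * (1 - z) powr \<alpha>)"
proof -
  have "(\<lambda>n. (\<alpha> gchoose n) * (- z) ^ n) sums (1 + - z) powr \<alpha>"
    using assms by (intro gen_binomial_real) auto
  moreover have "(\<alpha> gchoose n) * (- z) ^ n = \<omega> \<alpha> n * z ^ n" for n
    by (simp add: \<omega>_def power_minus[of z])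
  ultimately have S: "(\<lambda>n. \<omega> \<alpha> n * z ^ n) sums (1 - z) powr \<alpha>"
    by simp
  \<comment> \<open>Multiplying the binomial series by z^m shifts its coefficients by m. The leading
    zeros match the missing terms in the special cases of \<open>g\<close> at 0, 1 and 2.\<close>
  have shifted: "(\<lambda>k. if k < m then 0 else c * \<omega> \<alpha> (k - m) * z ^ k) sums (c * z ^ m * (1 - z) powr \<alpha>)"
    for m and c :: real
  proof -
    have "(\<lambda>k. c * z ^ m * (\<omega> \<alpha> k * z ^ k)) sums (c * z ^ m * (1 - z) powr \<alpha>)"
      by (intro sums_mult S)
    then have "(\<lambda>k. if k + m < m then 0 else c * \<omega> \<alpha> (k + m - m) * z ^ (k + m))
        sums (c * z ^ m * (1 - z) powr \<alpha>)"
      by (simp add: power_add mult_ac)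
    then show ?thesis
      by (subst (asm) sums_zero_iff_shift) auto
  qed
  have "g \<alpha> \<gamma>4 0 0 k * z ^ k =
      (if k < 0 then 0 else \<gamma>1 \<alpha> \<gamma>4 * \<omega> \<alpha> (k - 0) * z ^ k)
      + (if k < 1 then 0 else \<gamma>2 \<alpha> \<gamma>4 * \<omega> \<alpha> (k - 1) * z ^ k)
      + (if k < 2 then 0 else \<gamma>3 \<alpha> \<gamma>4 * \<omega> \<alpha> (k - 2) * z ^ k)
      + (if k < 3 then 0 else \<gamma>4 * \<omega> \<alpha> (k - 3) * z ^ k)" for k
  proof -
    consider "k = 0" | "k = 1" | "k = 2" | "3 \<le> k"
      by linarith
    then show ?thesis
      by cases (auto simp: g_def algebra_simps)
  qed
  moreover have "(\<lambda>k. (if k < 0 then 0 else \<gamma>1 \<alpha> \<gamma>4 * \<omega> \<alpha> (k - 0) * z ^ k)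
      + (if k < 1 then 0 else \<gamma>2 \<alpha> \<gamma>4 * \<omega> \<alpha> (k - 1) * z ^ k)
      + (if k < 2 then 0 else \<gamma>3 \<alpha> \<gamma>4 * \<omega> \<alpha> (k - 2) * z ^ k)
      + (if k < 3 then 0 else \<gamma>4 * \<omega> \<alpha> (k - 3) * z ^ k)) sums
      (\<gamma>1 \<alpha> \<gamma>4 * z ^ 0 * (1 - z) powr \<alpha> + \<gamma>2 \<alpha> \<gamma>4 * z ^ 1 * (1 - z) powr \<alpha>
       + \<gamma>3 \<alpha> \<gamma>4 * z ^ 2 * (1 - z) powr \<alpha> + \<gamma>4 * z ^ 3 * (1 - z) powr \<alpha>)"
    by (intro sums_add shifted)
  ultimately show ?thesis
    by (simp add: algebra_simps)
qed

text \<open>At \<open>z = 1\<close>, where the binomial series is no longer covered by the library theorem, the bound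
  on the partial sums follows by letting \<open>z\<close> tend to 1 from the left.\<close>
lemma untempered_partial_sum_le:
  fixes z :: real
  assumes "2 \<le> n" "0 < z" "z \<le> 1"
  shows "(\<Sum>k\<le>n. g \<alpha> \<gamma>4 0 0 k * z ^ k)
    \<le> (\<gamma>1 \<alpha> \<gamma>4 + \<gamma>2 \<alpha> \<gamma>4 * z + \<gamma>3 \<alpha> \<gamma>4 * z\<^sup>2 + \<gamma>4 * z ^ 3) * (1 - z) powr \<alpha>"
    (is "?L z \<le> ?R z")
proof -
  have less: "?L y \<le> ?R y" if "0 < y" "y < 1" for y
  proof -
    have s: "(\<lambda>k. g \<alpha> \<gamma>4 0 0 k * y ^ k) sums ?R y"
      using that by (intro untempered_weight_sums) auto
    \<comment> \<open>As n \<ge> 2, every omitted index is at least 3, so the omitted tail is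
      nonnegative.\<close>
    have "?L y \<le> (\<Sum>k. g \<alpha> \<gamma>4 0 0 k * y ^ k)"
      using assms(1) that sums_summable[OF s]
      by (intro sum_le_suminf) (auto intro!: mult_nonneg_nonneg untempered_weight_nonneg)
    then show ?thesis
      using sums_unique[OF s] by simp
  qed
  show ?thesis
  proof (cases "z = 1")
    case False
    then show ?thesis using less assms by simp
  next
    case True
    have "?L 1 \<le> ?R 1"
    proof (rule tendsto_le)
      show "(?L \<longlongrightarrow> ?L 1) (at_left 1)"
        by (intro tendsto_intros)
      \<comment> \<open>The base of the power tends to 0; its limit exists because the base is
        eventually nonnegative and the exponent \<alpha> is positive.\<close>
      have "\<forall>\<^sub>F y in at_left (1::real). 0 \<le> 1 - y"
        using eventually_at_left_real[of 0 "1::real"] by (auto elim!: eventually_mono)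
      then show "(?R \<longlongrightarrow> ?R 1) (at_left 1)"
        using \<alpha> by (intro tendsto_mult tendsto_powr' tendsto_intros) auto
      show "\<forall>\<^sub>F y in at_left 1. ?L y \<le> ?R y"
        using eventually_at_left_real[of 0 "1::real"] by (auto elim!: eventually_mono intro: less)
    qed simp
    then show ?thesis using True by simp
  qed
qed

text \<open>With z = exp(-h\<lambda>), \<phi> is the generating function of the untempered weights
  at z, divided by z. The case h\<lambda> = 0 is z = 1.\<close>

lemma partial_sum_le_phi:
  assumes "2 \<le> n" "0 \<le> h * lam"
  shows "(\<Sum>k\<le>n. g \<alpha> \<gamma>4 lam h k) \<le> \<phi> \<alpha> \<gamma>4 lam h"
proof -
  define z where "z = exp (- (h * lam))"
  have e: "exp (h * lam) = inverse z" "exp (- (2 * h * lam)) = z\<^sup>2"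
    unfolding z_def power2_eq_square exp_add[symmetric] by (simp_all add: exp_minus mult.assoc)
  have z: "0 < z" "z \<le> 1"
    using assms by (simp_all add: z_def)
  have "(\<Sum>k\<le>n. g \<alpha> \<gamma>4 lam h k) = (\<Sum>k\<le>n. g \<alpha> \<gamma>4 0 0 k * z ^ k) * inverse z"
    unfolding g_temper[of _ _ lam] e(1) z_def[symmetric] by (simp add: sum_distrib_right)
  also have "\<dots> \<le> (\<gamma>1 \<alpha> \<gamma>4 + \<gamma>2 \<alpha> \<gamma>4 * z + \<gamma>3 \<alpha> \<gamma>4 * z\<^sup>2 + \<gamma>4 * z ^ 3) * (1 - z) powr \<alpha> * inverse z"
    using z untempered_partial_sum_le[OF assms(1) z] by (intro mult_right_mono) auto
  also have "\<dots> = \<phi> \<alpha> \<gamma>4 lam h"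
    unfolding \<phi>_def e z_def[symmetric] using z
    by (simp add: field_simps power2_eq_square power3_eq_cube)
  finally show ?thesis .
qed

end

section \<open>The quadratic form of \<open>B\<close>\<close>

text \<open>After symmetrization, 2 x_i x_l \<le> x_i^2 + x_l^2 is applied off the diagonal, and on
  the diagonal it is an equality. What remains is a sum of row sums with weights x_i^2.\<close>

lemma quadratic_form_nonpos:
  fixes f :: "nat \<Rightarrow> nat \<Rightarrow> real" and x :: "nat \<Rightarrow> real"
  assumes off: "\<And>i l. i < n \<Longrightarrow> l < n \<Longrightarrow> i \<noteq> l \<Longrightarrow> 0 \<le> f i l + f l i"
    and row: "\<And>i. i < n \<Longrightarrow> (\<Sum>l<n. f i l + f l i) \<le> 0"
  shows "(\<Sum>i<n. \<Sum>l<n. f i l * x i * x l) \<le> 0"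
proof -
  define s where "s i l = f i l + f l i" for i l
  have swap: "(\<Sum>i<n. \<Sum>l<n. t i l) = (\<Sum>i<n. \<Sum>l<n. t l i)" for t :: "nat \<Rightarrow> nat \<Rightarrow> real"
    by (rule sum.swap)
  have "2 * (\<Sum>i<n. \<Sum>l<n. f i l * x i * x l)
      = (\<Sum>i<n. \<Sum>l<n. f i l * x i * x l) + (\<Sum>i<n. \<Sum>l<n. f l i * x l * x i)"
    using swap[of "\<lambda>i l. f i l * x i * x l"] by simp
  also have "\<dots> = (\<Sum>i<n. \<Sum>l<n. s i l * (x i * x l))"
    by (simp add: sum.distrib[symmetric] s_def algebra_simps)
  also have "\<dots> \<le> (\<Sum>i<n. \<Sum>l<n. s i l * (((x i)\<^sup>2 + (x l)\<^sup>2) / 2))"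
  proof (intro sum_mono)
    fix i l assume il: "i \<in> {..<n}" "l \<in> {..<n}"
    show "s i l * (x i * x l) \<le> s i l * (((x i)\<^sup>2 + (x l)\<^sup>2) / 2)"
    proof (cases "i = l")
      case True
      then show ?thesis by (simp add: power2_eq_square)
    next
      case False
      have "0 \<le> (x i - x l)\<^sup>2"
        by simp
      then have "x i * x l \<le> ((x i)\<^sup>2 + (x l)\<^sup>2) / 2"
        by (simp add: power2_eq_square algebra_simps)
      then show ?thesis
        using il off[of i l] False unfolding s_def by (intro mult_left_mono) auto
    qed
  qed
  \<comment> \<open>Since \<open>s\<close> is symmetric, the half with x_l can be written with
    \<open>s l i\<close>; interchanging the sums then merges it with the other half.\<close>
  also have "\<dots> = (\<Sum>i<n. \<Sum>l<n. s i l * (x i)\<^sup>2 / 2) + (\<Sum>i<n. \<Sum>l<n. s l i * (x l)\<^sup>2 / 2)"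
    unfolding sum.distrib[symmetric] s_def by (intro sum.cong refl) (simp add: field_simps)
  also have "\<dots> = (\<Sum>i<n. \<Sum>l<n. s i l * (x i)\<^sup>2)"
    by (subst (2) swap) (simp add: sum.distrib[symmetric])
  also have "\<dots> = (\<Sum>i<n. (x i)\<^sup>2 * (\<Sum>l<n. s i l))"
    by (simp add: sum_distrib_right mult.commute)
  also have "\<dots> \<le> 0"
    by (intro sum_nonpos) (simp add: mult_nonneg_nonpos row s_def)
  finally show ?thesis
    by simp
qed

text \<open>Row i of a symmetric Toeplitz matrix meets the distances 1 to i on the left of the
  diagonal and 1 to n - i - 1 on its right. Nonnegativity allows both ranges to be enlarged to 1 to
  n, which makes the bound uniform in i.\<close>

lemma sum_distance_le:
  fixes w :: "nat \<Rightarrow> real"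
  assumes "\<And>d. 1 \<le> d \<Longrightarrow> 0 \<le> w d" "i < n"
  shows "(\<Sum>l<n. if l = i then c else if l < i then w (i - l) else w (l - i)) \<le> c + 2 * (\<Sum>d=1..n. w d)"
proof -
  let ?t = "\<lambda>l. if l = i then c else if l < i then w (i - l) else w (l - i)"
  have split: "{..<n} = {..<i} \<union> ({i} \<union> {i<..<n})"
    using assms(2) by auto
  have "(\<Sum>l<n. ?t l) = (\<Sum>l<i. ?t l) + (\<Sum>l\<in>{i} \<union> {i<..<n}. ?t l)"
    unfolding split by (rule sum.union_disjoint) auto
  also have "(\<Sum>l\<in>{i} \<union> {i<..<n}. ?t l) = c + (\<Sum>l\<in>{i<..<n}. ?t l)"
    by (subst sum.union_disjoint) auto
  also have "(\<Sum>l<i. ?t l) = (\<Sum>d=1..i. w d)"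
    by (rule sum.reindex_bij_witness[of _ "\<lambda>d. i - d" "\<lambda>l. i - l"]) auto
  also have "(\<Sum>l\<in>{i<..<n}. ?t l) = (\<Sum>d=1..n - i - 1. w d)"
    by (rule sum.reindex_bij_witness[of _ "\<lambda>d. i + d" "\<lambda>l. l - i"]) auto
  finally have "(\<Sum>l<n. ?t l) = (\<Sum>d=1..i. w d) + (c + (\<Sum>d=1..n - i - 1. w d))" .
  moreover have "(\<Sum>d=1..i. w d) \<le> (\<Sum>d=1..n. w d)" "(\<Sum>d=1..n - i - 1. w d) \<le> (\<Sum>d=1..n. w d)"
    using assms by (auto intro!: sum_mono2)
  ultimately show ?thesis
    by linarith
qed

section \<open>Nonpositivity of the forms of \<open>B\<close> and of the Crank-Nicolson
  matrix\<close>

lemma B_carrier [simp]: "B \<alpha> \<gamma>4 lam h n \<in> carrier_mat n n"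
  by (simp add: B_def)

lemma scalar_prod_mult_mat_vec:
  fixes A :: "real mat"
  assumes "A \<in> carrier_mat n n" "v \<in> carrier_vec n"
  shows "v \<bullet> (A *\<^sub>v v) = (\<Sum>i<n. \<Sum>l<n. A $$ (i, l) * v $ i * v $ l)"
  using assms
  by (auto simp: scalar_prod_def sum_distrib_left atLeast0LessThan mult_ac intro!: sum.cong)

lemma B_form_nonpos:
  assumes \<alpha>: "1.26 < \<alpha>" "\<alpha> < 1.71" and \<gamma>4: "a3 \<alpha> < \<gamma>4" "\<gamma>4 < a4 \<alpha>"
    and hl: "0 \<le> h * lam" and v: "v \<in> carrier_vec n"
  shows "v \<bullet> (B \<alpha> \<gamma>4 lam h n *\<^sub>v v) \<le> 0"
proof -
  let ?g = "g \<alpha> \<gamma>4 lam h"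
  let ?B = "\<lambda>i l. B \<alpha> \<gamma>4 lam h n $$ (i, l)"
  \<comment> \<open>\<open>w d\<close> is the entry of \<open>B\<close> plus its transpose at
    distance d from the diagonal, and \<open>c\<close> is its diagonal entry. The superdiagonal of
    \<open>B\<close> contributes only at distance 1.\<close>
  define w where "w d = ?g (d + 1) + (if d = 1 then ?g 0 else 0)" for d
  define c where "c = 2 * (?g 1 - \<phi> \<alpha> \<gamma>4 lam h)"
  have w: "0 \<le> w d" if "1 \<le> d" for d
  proof (cases "d = 1")
    case True
    then show ?thesis
      using weight_0_2_nonneg[OF \<alpha> \<gamma>4 hl] by (simp add: w_def numeral_2_eq_2)
  next
    case False
    then show ?thesis
      using that weight_nonneg[OF \<alpha> \<gamma>4, of "d + 1"] by (simp add: w_def)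
  qed
  have sym: "?B i l + ?B l i = (if l = i then c else if l < i then w (i - l) else w (l - i))"
    if "i < n" "l < n" for i l
  proof -
    consider "l = i" | "l < i" | "i < l"
      by linarith
    then show ?thesis
      using that by cases (auto simp: B_def w_def c_def)
  qed
  have row: "(\<Sum>l<n. ?B i l + ?B l i) \<le> 0" if i: "i < n" for i
  proof -
    have n: "1 \<le> n"
      using i by simp
    have "(\<Sum>l<n. ?B i l + ?B l i)
        = (\<Sum>l<n. if l = i then c else if l < i then w (i - l) else w (l - i))"
      using sym[OF i] by (intro sum.cong) auto
    also have "\<dots> \<le> c + 2 * (\<Sum>d=1..n. w d)"
      using w i by (rule sum_distance_le)
    also have "(\<Sum>d=1..n. w d) = (\<Sum>d=1..n. ?g (d + 1)) + ?g 0"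
      using n by (simp add: w_def sum.distrib)
    also have "(\<Sum>d=1..n. ?g (d + 1)) = (\<Sum>k=2..n + 1. ?g k)"
      using sum.shift_bounds_cl_nat_ivl[of ?g 1 1 n] by (simp add: numeral_2_eq_2)
    also have "(\<Sum>k=2..n + 1. ?g k) + ?g 0 = (\<Sum>k\<le>n + 1. ?g k) - ?g 1"
    proof -
      have split: "{..n + 1} = {0, 1} \<union> {2..n + 1}"
        by auto
      have "(\<Sum>k\<le>n + 1. ?g k) = (\<Sum>k\<in>{0, 1}. ?g k) + (\<Sum>k=2..n + 1. ?g k)"
        unfolding split by (rule sum.union_disjoint) auto
      then show ?thesis
        by simp
    qed
    \<comment> \<open>The weight at 1 cancels against the diagonal, leaving twice the partial sum of
      the weights minus \<phi>.\<close>
    also have "c + 2 * ((\<Sum>k\<le>n + 1. ?g k) - ?g 1) \<le> 0"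
      using partial_sum_le_phi[OF \<alpha> \<gamma>4 _ hl, of "n + 1"] n by (simp add: c_def)
    finally show ?thesis .
  qed
  have "(\<Sum>i<n. \<Sum>l<n. ?B i l * v $ i * v $ l) \<le> 0"
    by (rule quadratic_form_nonpos) (use sym w row in auto)
  then show ?thesis
    by (simp only: scalar_prod_mult_mat_vec[OF B_carrier v])
qed

lemma cn_mat_carrier [simp]: "cn_mat \<alpha> \<gamma>4 lam cl cr h \<tau> n \<in> carrier_mat n n"
  by (simp add: cn_mat_def)

text \<open>A matrix and its transpose have the same quadratic form, so only the sum of the two
  coefficients matters; one of them may be negative.\<close>

lemma cn_mat_form_nonpos:
  assumes \<alpha>: "1.26 < \<alpha>" "\<alpha> < 1.71" and \<gamma>4: "a3 \<alpha> < \<gamma>4" "\<gamma>4 < a4 \<alpha>"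
    and hl: "0 \<le> h * lam" and \<tau>: "0 \<le> \<tau>" and c: "0 \<le> cl + cr" and v: "v \<in> carrier_vec n"
  shows "v \<bullet> (cn_mat \<alpha> \<gamma>4 lam cl cr h \<tau> n *\<^sub>v v) \<le> 0"
proof -
  let ?B = "B \<alpha> \<gamma>4 lam h n"
  let ?c = "\<tau> / (2 * h powr \<alpha>)"
  define S where "S = (\<Sum>i<n. \<Sum>l<n. ?B $$ (i, l) * v $ i * v $ l)"
  have entry: "cn_mat \<alpha> \<gamma>4 lam cl cr h \<tau> n $$ (i, l) = ?c * (cl * ?B $$ (i, l) + cr * ?B $$ (l, i))"
    if "i < n" "l < n" for i l
    using that carrier_matD[OF B_carrier[of \<alpha> \<gamma>4 lam h n]] by (simp add: cn_mat_def)
  have S: "S \<le> 0"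
    using B_form_nonpos[OF \<alpha> \<gamma>4 hl v] by (simp only: scalar_prod_mult_mat_vec[OF B_carrier v] S_def)
  have "v \<bullet> (cn_mat \<alpha> \<gamma>4 lam cl cr h \<tau> n *\<^sub>v v)
      = (\<Sum>i<n. \<Sum>l<n. ?c * (cl * ?B $$ (i, l) + cr * ?B $$ (l, i)) * v $ i * v $ l)"
    unfolding scalar_prod_mult_mat_vec[OF cn_mat_carrier v] by (intro sum.cong refl) (simp add: entry)
  also have "\<dots> = ?c * cl * S + ?c * cr * (\<Sum>i<n. \<Sum>l<n. ?B $$ (l, i) * v $ l * v $ i)"
    unfolding S_def sum_distrib_left sum.distrib[symmetric]
    by (intro sum.cong refl) (simp add: algebra_simps)
  also have "(\<Sum>i<n. \<Sum>l<n. ?B $$ (l, i) * v $ l * v $ i) = S"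
    unfolding S_def by (rule sum.swap)
  also have "?c * cl * S + ?c * cr * S = ?c * (cl + cr) * S"
    by (simp add: algebra_simps add_divide_distrib)
  also have "\<dots> \<le> 0"
    using S \<tau> c by (intro mult_nonneg_nonpos) auto
  finally show ?thesis .
qed

section \<open>The Crank--Nicolson energy estimate\<close>

context
  fixes A :: "real mat" and n :: nat
  assumes A: "A \<in> carrier_mat n n"
    and form_nonpos: "\<And>v. v \<in> carrier_vec n \<Longrightarrow> v \<bullet> (A *\<^sub>v v) \<le> 0"
begin

text \<open>Used with v = 0 to show that I - A is injective, and with differences of two solutions
  to obtain stability.\<close>

lemma crank_nicolson_step_le:
  assumes u: "u \<in> carrier_vec n" and v: "v \<in> carrier_vec n"
    and eq: "(1\<^sub>m n - A) *\<^sub>v u = (1\<^sub>m n + A) *\<^sub>v v"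
  shows "u \<bullet> u \<le> v \<bullet> v"
proof -
  have Au: "A *\<^sub>v u \<in> carrier_vec n" and Av: "A *\<^sub>v v \<in> carrier_vec n"
    using A u v by auto
  have "u - A *\<^sub>v u = v + A *\<^sub>v v"
    using eq u v A
    by (simp add: minus_mult_distrib_mat_vec[of _ n n] add_mult_distrib_mat_vec[of _ n n])
  then have "u $ i - (A *\<^sub>v u) $ i = v $ i + (A *\<^sub>v v) $ i" if "i < n" for i
    using that u v Au Av by (metis carrier_vecD index_add_vec(1) index_minus_vec(1))
  then have diff: "u - v = A *\<^sub>v (u + v)"
    using u v A Au Av
    by (intro eq_vecI)
      (auto simp del: index_mult_mat_vec simp: mult_add_distrib_mat_vec[of _ n n] algebra_simps)
  have "u \<bullet> u - v \<bullet> v = (u + v) \<bullet> (u - v)"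
    using u v by (simp add: scalar_prod_def sum_subtractf[symmetric] algebra_simps)
  also have "\<dots> \<le> 0"
    unfolding diff using u v by (intro form_nonpos) simp
  finally show ?thesis
    by simp
qed

text \<open>The step estimate with v = 0 makes the kernel of I - A trivial, so its determinant is
  nonzero.\<close>

lemma crank_nicolson_inverse:
  obtains C where "C \<in> carrier_mat n n" "(1\<^sub>m n - A) * C = 1\<^sub>m n"
proof -
  have I: "1\<^sub>m n - A \<in> carrier_mat n n"
    using A by (rule minus_carrier_mat)
  have "u = 0\<^sub>v n" if u: "u \<in> carrier_vec n" and k: "(1\<^sub>m n - A) *\<^sub>v u = 0\<^sub>v n" for u
  proof -
    have "(1\<^sub>m n + A) *\<^sub>v 0\<^sub>v n = 0\<^sub>v n"
      using A by (intro eq_vecI) auto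
    then have "u \<bullet> u \<le> 0\<^sub>v n \<bullet> 0\<^sub>v n"
      using u k by (intro crank_nicolson_step_le) auto
    then have "(\<Sum>i<n. u $ i * u $ i) \<le> 0"
      using u by (simp add: scalar_prod_def atLeast0LessThan)
    then have "(\<Sum>i<n. u $ i * u $ i) = 0"
      by (simp add: antisym sum_nonneg)
    then have "\<forall>i<n. u $ i = 0"
      by (subst (asm) sum_nonneg_eq_0_iff) auto
    then show ?thesis
      using u by (intro eq_vecI) auto
  qed
  then have "det (1\<^sub>m n - A) \<noteq> 0"
    using det_0_iff_vec_prod_zero_field[OF I] by blast
  \<comment> \<open>The \<open>()\<close> fills the extension field of the record
    \<open>ring_mat\<close>, whose units are the invertible matrices.\<close>
  from det_non_zero_imp_unit[OF I this, of "()"] show ?thesis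
    using that unfolding Units_def ring_mat_def by auto
qed

end

section \<open>Solvability and stability of the scheme\<close>

lemma cn_solution_exists:
  fixes \<alpha> \<gamma>4 lam cl cr h \<tau> :: real
  defines "A \<equiv> cn_mat \<alpha> \<gamma>4 lam cl cr h \<tau>"
  assumes form: "\<And>v. v \<in> carrier_vec n \<Longrightarrow> v \<bullet> (A n *\<^sub>v v) \<le> 0"
    and F: "\<forall>j<N. F j \<in> carrier_vec n" and u0: "u0 \<in> carrier_vec n"
  shows "\<exists>U. U 0 = u0 \<and> cn_solution \<alpha> \<gamma>4 lam cl cr h \<tau> n N F U"
proof -
  have A: "A n \<in> carrier_mat n n"
    by (simp add: A_def)
  obtain C where C: "C \<in> carrier_mat n n" "(1\<^sub>m n - A n) * C = 1\<^sub>m n"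
    using A form by (rule crank_nicolson_inverse)
  define U where "U = rec_nat u0 (\<lambda>j v. C *\<^sub>v ((1\<^sub>m n + A n) *\<^sub>v v + \<tau> \<cdot>\<^sub>v F j))"
  have U: "U 0 = u0" "U (Suc j) = C *\<^sub>v ((1\<^sub>m n + A n) *\<^sub>v U j + \<tau> \<cdot>\<^sub>v F j)" for j
    by (simp_all add: U_def)
  \<comment> \<open>The dimension of a successor value comes from the rows of \<open>C\<close>
    alone, so this holds for all j, also beyond N.\<close>
  have car: "U j \<in> carrier_vec n" for j
    using C u0 by (cases j) (auto simp: U intro!: carrier_vecI)
  have "(1\<^sub>m n - A n) *\<^sub>v U (j + 1) = (1\<^sub>m n + A n) *\<^sub>v U j + \<tau> \<cdot>\<^sub>v F j" if "j < N" for j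
  proof -
    let ?r = "(1\<^sub>m n + A n) *\<^sub>v U j + \<tau> \<cdot>\<^sub>v F j"
    have r: "?r \<in> carrier_vec n"
      using F that by (intro carrier_vecI) auto
    have "1\<^sub>m n - A n \<in> carrier_mat n n"
      using A by (rule minus_carrier_mat)
    then have "((1\<^sub>m n - A n) * C) *\<^sub>v ?r = (1\<^sub>m n - A n) *\<^sub>v (C *\<^sub>v ?r)"
      using C(1) r by (rule assoc_mult_mat_vec)
    then show ?thesis
      using C(2) r by (simp add: U)
  qed
  then show ?thesis
    using U(1) car unfolding cn_solution_def A_def by blast
qed

text \<open>The source term cancels in the difference of two solutions, so the difference follows
  the homogeneous scheme and its norm cannot grow in any step.\<close>

lemma cn_solution_diff_le:
  fixes \<alpha> \<gamma>4 lam cl cr h \<tau> :: real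
  defines "A \<equiv> cn_mat \<alpha> \<gamma>4 lam cl cr h \<tau>"
  assumes form: "\<And>v. v \<in> carrier_vec n \<Longrightarrow> v \<bullet> (A n *\<^sub>v v) \<le> 0"
    and F: "\<forall>j<N. F j \<in> carrier_vec n" and h: "0 \<le> h"
    and U: "cn_solution \<alpha> \<gamma>4 lam cl cr h \<tau> n N F U"
    and V: "cn_solution \<alpha> \<gamma>4 lam cl cr h \<tau> n N F V"
    and "j \<le> N"
  shows "discrete_L2_norm h (U j - V j) \<le> discrete_L2_norm h (U 0 - V 0)"
  using \<open>j \<le> N\<close>
proof (induction j)
  case 0
  show ?case by simp
next
  case (Suc j)
  have A: "A n \<in> carrier_mat n n"
    by (simp add: A_def)
  have car: "U j \<in> carrier_vec n" "V j \<in> carrier_vec n" "U (Suc j) \<in> carrier_vec n"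
      "V (Suc j) \<in> carrier_vec n" "F j \<in> carrier_vec n"
    using U V F Suc.prems unfolding cn_solution_def by auto
  have eqs: "(1\<^sub>m n - A n) *\<^sub>v U (Suc j) = (1\<^sub>m n + A n) *\<^sub>v U j + \<tau> \<cdot>\<^sub>v F j"
      "(1\<^sub>m n - A n) *\<^sub>v V (Suc j) = (1\<^sub>m n + A n) *\<^sub>v V j + \<tau> \<cdot>\<^sub>v F j"
    using U V Suc.prems unfolding cn_solution_def A_def by auto
  have "1\<^sub>m n - A n \<in> carrier_mat n n"
    using A by (rule minus_carrier_mat)
  then have "(1\<^sub>m n - A n) *\<^sub>v (U (Suc j) - V (Suc j))
      = ((1\<^sub>m n + A n) *\<^sub>v U j + \<tau> \<cdot>\<^sub>v F j) - ((1\<^sub>m n + A n) *\<^sub>v V j + \<tau> \<cdot>\<^sub>v F j)"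
    using car by (simp add: mult_minus_distrib_mat_vec[of _ n n] eqs)
  also have "\<dots> = (1\<^sub>m n + A n) *\<^sub>v U j - (1\<^sub>m n + A n) *\<^sub>v V j"
    using A car by (intro eq_vecI) (auto simp del: index_mult_mat_vec)
  also have "\<dots> = (1\<^sub>m n + A n) *\<^sub>v (U j - V j)"
    using A car by (simp add: mult_minus_distrib_mat_vec[of _ n n])
  finally have "(U (Suc j) - V (Suc j)) \<bullet> (U (Suc j) - V (Suc j)) \<le> (U j - V j) \<bullet> (U j - V j)"
    using car by (intro crank_nicolson_step_le[OF A form]) auto
  then have "discrete_L2_norm h (U (Suc j) - V (Suc j)) \<le> discrete_L2_norm h (U j - V j)"
    using h unfolding discrete_L2_norm_def
    by (intro real_sqrt_le_mono mult_left_mono)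
      (simp_all add: scalar_prod_def power2_eq_square atLeast0LessThan)
  then show ?case
    using Suc by simp
qed

text \<open>Positivity of \<open>cl + cr\<close> is the forward diffusion case; it fixes the sign of
  the quadratic form on which the energy estimate rests.\<close>

theorem mainTheorem2:
  fixes \<alpha> \<gamma>4 lam cl cr a b T :: real
  assumes "1.26 < \<alpha>" and "\<alpha> < 1.71"
    and "a3 \<alpha> < \<gamma>4" and "\<gamma>4 < a4 \<alpha>"
    and "0 \<le> lam"
    and "cl + cr > 0"
    and "a < b" and "0 < T"
  shows "unconditionally_stable a b T (cn_solution \<alpha> \<gamma>4 lam cl cr)"
  unfolding unconditionally_stable_def
\<comment> \<open>Every step is a contraction, so K = 1 serves all meshes and time steps.\<close>
proof (intro exI[of _ 1] allI impI)
  fix M N n :: nat and h \<tau> :: real and F :: "nat \<Rightarrow> real vec"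
  assume h: "h = (b - a) / real M" and \<tau>: "\<tau> = T / real N" and F: "\<forall>j<N. F j \<in> carrier_vec n"
  have h0: "0 \<le> h" and "0 \<le> \<tau>"
    using assms h \<tau> by simp_all
  then have "v \<bullet> (cn_mat \<alpha> \<gamma>4 lam cl cr h \<tau> n *\<^sub>v v) \<le> 0" if "v \<in> carrier_vec n" for v
    using assms that by (intro cn_mat_form_nonpos) auto
  note form = this
  show "(\<forall>u0 \<in> carrier_vec n. \<exists>U. U 0 = u0 \<and> cn_solution \<alpha> \<gamma>4 lam cl cr h \<tau> n N F U) \<and>
      (\<forall>U V. cn_solution \<alpha> \<gamma>4 lam cl cr h \<tau> n N F U \<longrightarrow> cn_solution \<alpha> \<gamma>4 lam cl cr h \<tau> n N F V \<longrightarrow>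
        (\<forall>j\<le>N. discrete_L2_norm h (U j - V j) \<le> 1 * discrete_L2_norm h (U 0 - V 0)))"
    using cn_solution_exists[OF form F] cn_solution_diff_le[OF form F h0] by simp
qed

end
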